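(* Let $G$ be a graph and let $a,b$ be integers with $b\ge 1$ and $\frac ab\in[0,1]$. Then the function $p\mapsto\hat\rho(G,p)$ has no breakpoint $p$ with $0<|p-\frac ab|<(3b)^{-|E(G)|}$.
   Context: Graphs are finite, undirected, simple, with distinguished sender $s$ and receiver $r$. Each edge survives independently with the same probability $p\in(0,1)$. An instruction is a triple $uvw$ with $u,w$ distinct neighbors of $v$; a protocol $A$ is a set of instructions; an $A$-walk is an $s,r$-walk all of whose consecutive triples lie in $A$; $A$ is finite if there are finitely many $A$-walks; $\rho_A(G,p)$ is the probability that all edges of some $A$-walk survive; $\hat\rho(G,p)=\max\{\rho_A(G,p):A$ finite protocol$\}$ (a piecewise polynomial function of $p$). For a piecewise polynomial function $f$, a breakpoint (of order $m$) is a point $z\in(0,1)$ such that $f$ is $m-1$ times differentiable at $z$ but not $m$ times (0 times differentiable meaning continuous); equivalently, there are distinct polynomials $q_1,q_2$ and $\varepsilon>0$ with $f=q_1$ on $(z-\varepsilon,z]$ and $f=q_2$ on $[z,z+\varepsilon)$. *)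

theory Defs
  imports "HOL-Probability.Probability"
begin

section \<open>Graphs, protocols and walks\<close>

definition simple_graph :: "'v set \<Rightarrow> 'v set set \<Rightarrow> bool" where
  "simple_graph V E \<longleftrightarrow> finite V \<and> (\<forall>e\<in>E. e \<subseteq> V \<and> card e = 2)"

text \<open>The triple \<open>(u, v, w)\<close> is the instruction written \<open>uvw\<close>.\<close>

definition instructions :: "'v set set \<Rightarrow> ('v \<times> 'v \<times> 'v) set" where
  "instructions E = {(u, v, w). {u, v} \<in> E \<and> {v, w} \<in> E \<and> u \<noteq> w}"

text \<open>A walk is given by its vertex sequence; vertices and edges may repeat.\<close>

definition walks :: "'v set \<Rightarrow> 'v set set \<Rightarrow> 'v \<Rightarrow> 'v \<Rightarrow> 'v list set" where
  "walks V E s r = {xs. xs \<noteq> [] \<and> set xs \<subseteq> V \<and> hd xs = s \<and> last xs = r \<and>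
     successively (\<lambda>u v. {u, v} \<in> E) xs}"

definition walk_edges :: "'v list \<Rightarrow> 'v set set" where
  "walk_edges xs = {{xs ! i, xs ! Suc i} | i. Suc i < length xs}"

text \<open>A walk with at most two vertices has no consecutive triple, so it is an
  \<open>A\<close>-walk for every \<open>A\<close>.\<close>

definition protocol_walks ::
  "'v set \<Rightarrow> 'v set set \<Rightarrow> 'v \<Rightarrow> 'v \<Rightarrow> ('v \<times> 'v \<times> 'v) set \<Rightarrow> 'v list set" where
  "protocol_walks V E s r A = {xs \<in> walks V E s r.
     \<forall>i. i + 2 < length xs \<longrightarrow> (xs ! i, xs ! (i + 1), xs ! (i + 2)) \<in> A}"

definition finite_protocols ::
  "'v set \<Rightarrow> 'v set set \<Rightarrow> 'v \<Rightarrow> 'v \<Rightarrow> ('v \<times> 'v \<times> 'v) set set" where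
  "finite_protocols V E s r = {A. A \<subseteq> instructions E \<and> finite (protocol_walks V E s r A)}"

section \<open>Reliability\<close>

text \<open>An outcome \<open>\<omega>\<close> tells for each edge whether it survives.\<close>

definition survival_pmf :: "'v set set \<Rightarrow> real \<Rightarrow> ('v set \<Rightarrow> bool) pmf" where
  "survival_pmf E p = Pi_pmf E False (\<lambda>_. bernoulli_pmf p)"

definition rho ::
  "'v set \<Rightarrow> 'v set set \<Rightarrow> 'v \<Rightarrow> 'v \<Rightarrow> ('v \<times> 'v \<times> 'v) set \<Rightarrow> real \<Rightarrow> real" where
  "rho V E s r A p = measure_pmf.prob (survival_pmf E p)
     {\<omega>. \<exists>xs \<in> protocol_walks V E s r A. \<forall>e \<in> walk_edges xs. \<omega> e}"

text \<open>For a finite graph this is the maximum of a finite set, nonempty because the empty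
  protocol is finite. Only the values at \<open>0 < p < 1\<close> are meaningful: the parameter of
  \<^const>\<open>bernoulli_pmf\<close> is clamped to the unit interval.\<close>

definition rho_hat :: "'v set \<Rightarrow> 'v set set \<Rightarrow> 'v \<Rightarrow> 'v \<Rightarrow> real \<Rightarrow> real" where
  "rho_hat V E s r p = Max ((\<lambda>A. rho V E s r A p) ` finite_protocols V E s r)"

section \<open>Breakpoints\<close>

text \<open>Being \<open>m\<close> times differentiable at a point, for \<open>m \<ge> 2\<close>, requires the derivative to exist
  in a neighbourhood and to be \<open>m - 1\<close> times differentiable at the point; the \<open>m\<close>-th derivative
  itself need not be continuous there.\<close>

fun times_differentiable_at :: "nat \<Rightarrow> (real \<Rightarrow> real) \<Rightarrow> real \<Rightarrow> bool" where
  "times_differentiable_at 0 f z \<longleftrightarrow> isCont f z"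
| "times_differentiable_at (Suc 0) f z \<longleftrightarrow> f differentiable (at z)"
| "times_differentiable_at (Suc (Suc m)) f z \<longleftrightarrow>
     (\<forall>\<^sub>F x in nhds z. f differentiable (at x)) \<and> times_differentiable_at (Suc m) (deriv f) z"

definition breakpoint_of_order :: "nat \<Rightarrow> (real \<Rightarrow> real) \<Rightarrow> real \<Rightarrow> bool" where
  "breakpoint_of_order m f z \<longleftrightarrow> 1 \<le> m \<and> z \<in> {0<..<1} \<and>
     times_differentiable_at (m - 1) f z \<and> \<not> times_differentiable_at m f z"

definition breakpoint :: "(real \<Rightarrow> real) \<Rightarrow> real \<Rightarrow> bool" where
  "breakpoint f z \<longleftrightarrow> (\<exists>m. breakpoint_of_order m f z)"

end

theory Submission
  imports Defs
begin

text \<open>On the unit interval every \<open>rho A\<close> is a polynomial in \<open>p\<close>, namely the sum of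
  \<open>p ^ |S| * (1 - p) ^ (|E| - |S|)\<close> over the surviving edge sets \<open>S\<close> that contain an
  \<open>A\<close>-walk. Near a point where all polynomials attaining the maximum coincide, \<open>rho_hat\<close> is a
  single polynomial and hence smooth; so a breakpoint is a common value of two distinct such
  polynomials. After the substitution \<open>p = a/b + x\<close> and multiplication by \<open>b ^ |E|\<close>, their
  difference is a nonzero integer polynomial in \<open>x\<close> whose absolute coefficients sum up to at most
  \<open>(a + b + (b - a) + b) ^ |E| = (3 * b) ^ |E|\<close>. The lowest nonzero coefficient has absolute value
  at least \<open>1\<close>, which keeps every nonzero root at distance at least \<open>(3 * b) ^ - |E|\<close> from \<open>0\<close>.\<close>

section \<open>The sum of the absolute coefficients of a polynomial\<close>

text \<open>This norm is submultiplicative and dominates the values on [-1, 1], so it can be bounded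
  factor by factor and then played against a root.\<close>

definition l1_norm :: "'a::linordered_idom poly \<Rightarrow> 'a" where
  "l1_norm q = (\<Sum>c\<leftarrow>coeffs q. \<bar>c\<bar>)"

lemma l1_norm_0 [simp]: "l1_norm 0 = 0"
  by (simp add: l1_norm_def)

lemma l1_norm_pCons [simp]: "l1_norm (pCons c q) = \<bar>c\<bar> + l1_norm q"
  by (simp add: l1_norm_def cCons_def)

lemma l1_norm_1 [simp]: "l1_norm 1 = 1"
  by (simp add: one_pCons)

lemma l1_norm_nonneg: "0 \<le> l1_norm q"
  by (induction q) auto

lemma l1_norm_add_le: "l1_norm (q + r) \<le> l1_norm q + l1_norm r"
proof (induction q r rule: poly_induct2)
  case (pCons c q d r)
  then show ?case
    using abs_triangle_ineq[of c d] by simp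
qed simp

lemma l1_norm_smult: "l1_norm (smult c q) = \<bar>c\<bar> * l1_norm q"
  by (induction q) (auto simp: abs_mult algebra_simps)

lemma l1_norm_sum_le: "l1_norm (\<Sum>i\<in>I. q i) \<le> (\<Sum>i\<in>I. l1_norm (q i))"
proof (induction I rule: infinite_finite_induct)
  case (insert i I)
  then show ?case
    using l1_norm_add_le[of "q i" "\<Sum>i\<in>I. q i"] by simp
qed auto

lemma l1_norm_mult_le: "l1_norm (q * r) \<le> l1_norm q * l1_norm r"
proof (induction q)
  case (pCons c q)
  have "l1_norm (pCons c q * r) \<le> l1_norm (smult c r) + l1_norm (pCons 0 (q * r))"
    unfolding mult_pCons_left by (rule l1_norm_add_le)
  also have "\<dots> \<le> \<bar>c\<bar> * l1_norm r + l1_norm q * l1_norm r"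
    using pCons.IH by (simp add: l1_norm_smult)
  finally show ?case
    by (simp add: distrib_right)
qed simp

lemma l1_norm_power_le: "l1_norm (q ^ n) \<le> l1_norm q ^ n"
proof (induction n)
  case (Suc n)
  have "l1_norm (q ^ Suc n) \<le> l1_norm q * l1_norm (q ^ n)"
    by (simp add: l1_norm_mult_le)
  also have "\<dots> \<le> l1_norm q * l1_norm q ^ n"
    using Suc.IH l1_norm_nonneg by (rule mult_left_mono)
  finally show ?case
    by simp
qed simp

lemma abs_poly_le_l1_norm:
  assumes "\<bar>x\<bar> \<le> 1"
  shows "\<bar>poly q x\<bar> \<le> l1_norm q"
proof (induction q)
  case (pCons c q)
  have "\<bar>x * poly q x\<bar> \<le> 1 * \<bar>poly q x\<bar>"
    unfolding abs_mult using assms by (intro mult_right_mono) auto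
  then show ?case
    using pCons.IH by simp
qed simp

text \<open>Zero constant coefficients are divided out, as x is nonzero. At the first nonzero one, c
  = - x * \<open>poly q x\<close> with |c| at least 1 by integrality, while \<open>l1_norm q\<close>
  bounds |\<open>poly q x\<close>|.\<close>

lemma nonzero_root_lower_bound:
  fixes q :: "real poly"
  assumes "q \<noteq> 0" "\<And>i. coeff q i \<in> \<int>" "poly q x = 0" "x \<noteq> 0" "\<bar>x\<bar> \<le> 1"
  shows "1 \<le> \<bar>x\<bar> * l1_norm q"
  using assms(1-3)
proof (induction q)
  case (pCons c q)
  show ?case
  proof (cases "c = 0")
    case True
    have "coeff q i \<in> \<int>" for i
      using pCons.prems(2)[of "Suc i"] by simp
    with True show ?thesis
      using pCons assms(4) by auto
  next
    case False
    have "c \<in> \<int>"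
      using pCons.prems(2)[of 0] by simp
    with False have "1 \<le> \<bar>c\<bar>"
      by (simp add: Ints_nonzero_abs_ge1)
    also have "\<bar>c\<bar> = \<bar>x\<bar> * \<bar>poly q x\<bar>"
      using pCons.prems(3) by (simp add: add_eq_0_iff2 flip: abs_mult)
    also have "\<dots> \<le> \<bar>x\<bar> * l1_norm (pCons c q)"
      using abs_poly_le_l1_norm[OF assms(5), of q] by (intro mult_left_mono) auto
    finally show ?thesis .
  qed
qed simp

section \<open>Reliability polynomials\<close>

text \<open>With n = \<open>card E\<close> and F a family of subsets of E, the value at p in [0, 1]
  is the probability that the set of surviving edges belongs to F; the subtraction then never
  truncates.\<close>

definition edge_set_poly :: "nat \<Rightarrow> 'e set set \<Rightarrow> real poly" where
  "edge_set_poly n F = (\<Sum>S\<in>F. [:0, 1:] ^ card S * [:1, -1:] ^ (n - card S))"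

lemma poly_edge_set_poly:
  "poly (edge_set_poly n F) y = (\<Sum>S\<in>F. y ^ card S * (1 - y) ^ (n - card S))"
  by (simp add: edge_set_poly_def poly_sum)

lemma coeff_power_Ints:
  fixes q :: "'a::comm_ring_1 poly"
  assumes "\<And>i. coeff q i \<in> \<int>"
  shows "coeff (q ^ n) i \<in> \<int>"
proof (induction n arbitrary: i)
  case (Suc n)
  then show ?case
    using assms by (auto simp: coeff_mult intro!: Ints_sum Ints_mult)
qed (auto simp: coeff_1)

lemma coeff_linear_Ints:
  assumes "c \<in> \<int>" "d \<in> \<int>"
  shows "coeff [:c, d:] i \<in> \<int>"
  using assms by (auto simp: coeff_pCons split: nat.split)

text \<open>Binomial expansion with one factor per element of E: the subset S records which factors
  contribute u.\<close>

lemma sum_Pow_power_card: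
  fixes u v :: "'a::comm_semiring_1"
  assumes "finite E"
  shows "(\<Sum>S\<in>Pow E. u ^ card S * v ^ (card E - card S)) = (u + v) ^ card E"
proof -
  have "(u + v) ^ card E = (\<Prod>e\<in>E. u + v)"
    by simp
  also have "\<dots> = (\<Sum>S\<in>Pow E. (\<Prod>e\<in>S. u) * (\<Prod>e\<in>E - S. v))"
    by (rule prod_add[OF assms])
  also have "\<dots> = (\<Sum>S\<in>Pow E. u ^ card S * v ^ (card E - card S))"
    using assms by (intro sum.cong) (auto simp: card_Diff_subset finite_subset)
  finally show ?thesis ..
qed

lemma edge_set_poly_eq:
  fixes a b :: int and z :: real
  assumes E: "finite E" "F \<subseteq> Pow E" "F' \<subseteq> Pow E"
    and ab: "b \<ge> 1" "0 \<le> a" "a \<le> b"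
    and z: "0 < \<bar>z - a / b\<bar>" "\<bar>z - a / b\<bar> < 1 / (3 * real_of_int b) ^ card E"
    and eq: "poly (edge_set_poly (card E) F) z = poly (edge_set_poly (card E) F') z"
  shows "edge_set_poly (card E) F = edge_set_poly (card E) F'"
proof -
  define n where "n = card E"
  \<comment> \<open>Sets in both families cancel here, so every weight is -1, 0 or 1. Bounding the
    two polynomials separately would cost a factor 2.\<close>
  define \<epsilon> :: "'a set \<Rightarrow> real" where "\<epsilon> S = of_bool (S \<in> F) - of_bool (S \<in> F')" for S
  \<comment> \<open>With y = a/b + x one has b * y = a + b * x and b * (1 - y) = (b - a) - b * x.
    The scalar b ^ n spreads over the n factors and clears the denominators.\<close>
  define R :: "'a set \<Rightarrow> real poly" where
    "R S = [:of_int a, of_int b:] ^ card S * [:of_int (b - a), - of_int b:] ^ (n - card S)" for S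
  define Q where "Q = (\<Sum>S\<in>Pow E. smult (\<epsilon> S) (R S))"
  have poly_Q: "poly Q (y - a / b) = b ^ n *
      (poly (edge_set_poly n F) y - poly (edge_set_poly n F') y)" for y :: real
  proof -
    have R: "poly (R S) (y - a / b) = b ^ n * (y ^ card S * (1 - y) ^ (n - card S))"
      if "S \<subseteq> E" for S
    proof -
      have "card S \<le> n"
        using that E(1) by (simp add: n_def card_mono)
      then have n: "real_of_int b ^ n = b ^ card S * b ^ (n - card S)"
        by (simp flip: power_add)
      have "a + (y - a / b) * b = b * y" "b - a - (y - a / b) * b = b * (1 - y)"
        using ab(1) by (simp_all add: field_simps)
      then show ?thesis
        by (simp add: R_def n power_mult_distrib mult_ac)
    qed
    have restrict: "(\<Sum>S\<in>Pow E. of_bool (S \<in> G) * g S) = sum g G" if "G \<subseteq> Pow E"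
      for g :: "'a set \<Rightarrow> real" and G
      using E(1) that by (simp add: of_bool_def if_distrib[of "\<lambda>c. c * _"] Int_absorb1
          flip: sum.inter_restrict cong: if_cong)
    have "poly Q (y - a / b) =
        (\<Sum>S\<in>Pow E. \<epsilon> S * (b ^ n * (y ^ card S * (1 - y) ^ (n - card S))))"
      unfolding Q_def poly_sum poly_smult by (intro sum.cong) (simp_all add: R)
    also have "\<dots> = b ^ n * ((\<Sum>S\<in>Pow E. of_bool (S \<in> F) * (y ^ card S * (1 - y) ^ (n - card S))) -
        (\<Sum>S\<in>Pow E. of_bool (S \<in> F') * (y ^ card S * (1 - y) ^ (n - card S))))"
      by (simp add: \<epsilon>_def sum_distrib_left left_diff_distrib right_diff_distrib mult_ac
          flip: sum_subtractf)
    finally show ?thesis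
      by (simp only: restrict E poly_edge_set_poly)
  qed
  have "l1_norm Q \<le> (\<Sum>S\<in>Pow E. l1_norm (R S))"
    unfolding Q_def
    by (rule order_trans[OF l1_norm_sum_le], rule sum_mono)
      (auto simp: l1_norm_smult \<epsilon>_def of_bool_def l1_norm_nonneg)
  \<comment> \<open>Since 0 \<le> a \<le> b, the two linear factors have norms a + b and (b - a) +
    b, whose sum is 3 * b whatever a is.\<close>
  also have "\<dots> \<le> (\<Sum>S\<in>Pow E. (a + b) ^ card S * (2 * b - a) ^ (n - card S))"
    unfolding of_int_sum
  proof (rule sum_mono)
    fix S
    have "l1_norm (R S) \<le> l1_norm [:real_of_int a, of_int b:] ^ card S *
        l1_norm [:real_of_int (b - a), - of_int b:] ^ (n - card S)"
      unfolding R_def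
      by (intro order_trans[OF l1_norm_mult_le] mult_mono l1_norm_power_le
          l1_norm_nonneg zero_le_power)
    then show "l1_norm (R S) \<le> real_of_int ((a + b) ^ card S * (2 * b - a) ^ (n - card S))"
      using ab by simp
  qed
  also have "\<dots> = (3 * b) ^ n"
    by (simp add: n_def sum_Pow_power_card[OF E(1)])
  finally have norm: "l1_norm Q \<le> (3 * b) ^ n" .
  have Ints: "coeff Q i \<in> \<int>" for i
    unfolding Q_def R_def coeff_sum coeff_smult coeff_mult \<epsilon>_def of_bool_def
    by (intro Ints_sum Ints_mult coeff_power_Ints coeff_linear_Ints) auto
  have "Q = 0"
  proof (rule ccontr)
    assume "Q \<noteq> 0"
    have pos: "0 < (3 * real_of_int b) ^ n"
      using ab(1) by simp
    \<comment> \<open>The root bound applies only at distance at most 1 from 0; this holds because 1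
      / (3 * b) ^ n is at most 1.\<close>
    have "1 \<le> (3 * real_of_int b) ^ n"
      using ab(1) by (intro one_le_power) simp
    then have "1 / (3 * real_of_int b) ^ n \<le> 1"
      by simp
    then have "\<bar>z - a / b\<bar> \<le> 1"
      using z(2) by (simp add: n_def)
    moreover have "poly Q (z - a / b) = 0"
      using eq by (simp add: poly_Q n_def)
    ultimately have "1 \<le> \<bar>z - a / b\<bar> * l1_norm Q"
      using \<open>Q \<noteq> 0\<close> Ints z(1) by (intro nonzero_root_lower_bound) auto
    also have "\<dots> \<le> \<bar>z - a / b\<bar> * (3 * b) ^ n"
      using norm by (intro mult_left_mono) auto
    also have "\<dots> < 1"
      using z(2) pos by (simp add: n_def field_simps)
    finally show False
      by simp
  qed
  then have "poly (edge_set_poly n F) y = poly (edge_set_poly n F') y" for y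
    using poly_Q[of y] ab(1) by simp
  then show ?thesis
    by (simp add: n_def poly_eq_poly_eq_iff[symmetric] fun_eq_iff)
qed

text \<open>Only indicator functions of subsets of E can carry mass, since the product distribution
  fixes \<open>False\<close> off E; independence gives each its weight.\<close>

lemma prob_survival_pmf:
  assumes "finite E" "p \<in> {0..1}"
  shows "measure_pmf.prob (survival_pmf E p) X =
    poly (edge_set_poly (card E) {S \<in> Pow E. (\<lambda>e. e \<in> S) \<in> X}) p"
proof -
  define F where "F = {S \<in> Pow E. (\<lambda>e. e \<in> S) \<in> X}"
  define Y where "Y = (\<lambda>S e. e \<in> S) ` F"
  have "finite F"
    using assms(1) by (simp add: F_def)
  \<comment> \<open>An outcome of X with support inside E would be the indicator of a member of F,
    so one outside Y is true somewhere off E.\<close>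
  have outside: "pmf (survival_pmf E p) \<omega> = 0" if "\<omega> \<in> X - Y" for \<omega>
  proof -
    have "{e. \<omega> e} \<notin> F"
    proof
      assume "{e. \<omega> e} \<in> F"
      then have "(\<lambda>e. e \<in> {e. \<omega> e}) \<in> Y"
        unfolding Y_def by (rule imageI)
      with that show False
        by simp
    qed
    then have "\<exists>e. e \<notin> E \<and> \<omega> e"
      using that by (auto simp: F_def)
    then show ?thesis
      using assms(1) by (auto simp: survival_pmf_def intro!: pmf_Pi_outside)
  qed
  have "measure_pmf.prob (survival_pmf E p) X = measure_pmf.prob (survival_pmf E p) Y"
  proof (rule measure_prob_cong_0)
    show "pmf (survival_pmf E p) \<omega> = 0" if "\<omega> \<in> X - Y" for \<omega>
      using that by (rule outside)
    show "pmf (survival_pmf E p) \<omega> = 0" if "\<omega> \<in> Y - X" for \<omega>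
      using that by (auto simp: Y_def F_def)
  qed
  also have "\<dots> = (\<Sum>\<omega>\<in>Y. pmf (survival_pmf E p) \<omega>)"
    using \<open>finite F\<close> by (intro measure_measure_pmf_finite) (simp add: Y_def)
  also have "\<dots> = (\<Sum>S\<in>F. pmf (survival_pmf E p) (\<lambda>e. e \<in> S))"
    unfolding Y_def by (subst sum.reindex) (auto simp: inj_on_def fun_eq_iff)
  also have "\<dots> = (\<Sum>S\<in>F. p ^ card S * (1 - p) ^ (card E - card S))"
  proof (rule sum.cong)
    fix S assume "S \<in> F"
    then have S: "S \<subseteq> E"
      by (simp add: F_def)
    have "pmf (survival_pmf E p) (\<lambda>e. e \<in> S) = (\<Prod>e\<in>E. pmf (bernoulli_pmf p) (e \<in> S))"
      unfolding survival_pmf_def using S assms(1) by (intro pmf_Pi') auto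
    also have "\<dots> = (\<Prod>e\<in>S. pmf (bernoulli_pmf p) (e \<in> S)) *
        (\<Prod>e\<in>E - S. pmf (bernoulli_pmf p) (e \<in> S))"
      using S assms(1) by (simp add: prod.subset_diff mult.commute)
    also have "\<dots> = (\<Prod>e\<in>S. p) * (\<Prod>e\<in>E - S. 1 - p)"
      using assms(2) by (intro arg_cong2[of _ _ _ _ "(*)"] prod.cong) auto
    also have "\<dots> = p ^ card S * (1 - p) ^ (card E - card S)"
      using S assms(1) by (simp add: card_Diff_subset finite_subset)
    finally show "pmf (survival_pmf E p) (\<lambda>e. e \<in> S) = \<dots>" .
  qed simp
  finally show ?thesis
    by (simp add: poly_edge_set_poly F_def)
qed

section \<open>Finiteness of the edge set and of the set of protocols\<close>

lemma finite_edges: "simple_graph V E \<Longrightarrow> finite E"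
  unfolding simple_graph_def by (auto intro: finite_subset[of E "Pow V"])

lemma finite_finite_protocols:
  assumes "simple_graph V E"
  shows "finite (finite_protocols V E s r)"
proof -
  have "instructions E \<subseteq> V \<times> V \<times> V"
    using assms by (auto simp: instructions_def simple_graph_def)
  then have "finite (instructions E)"
    using assms by (auto simp: simple_graph_def intro: finite_subset)
  then show ?thesis
    by (intro finite_subset[of "finite_protocols V E s r" "Pow (instructions E)"])
      (auto simp: finite_protocols_def)
qed

text \<open>Makes the set under the maximum nonempty. A third vertex would require an instruction,
  so only the finitely many lists of at most two vertices remain.\<close>

lemma empty_in_finite_protocols:
  assumes "simple_graph V E"
  shows "{} \<in> finite_protocols V E s r"
proof -
  have "protocol_walks V E s r {} \<subseteq> {xs. set xs \<subseteq> V \<and> length xs \<le> 2}"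
  proof
    fix xs assume xs: "xs \<in> protocol_walks V E s r {}"
    then have "\<not> 0 + 2 < length xs"
      unfolding protocol_walks_def by blast
    with xs show "xs \<in> {xs. set xs \<subseteq> V \<and> length xs \<le> 2}"
      by (simp add: protocol_walks_def walks_def)
  qed
  then show ?thesis
    using assms finite_lists_length_le[of V 2]
    by (auto simp: finite_protocols_def simple_graph_def intro: finite_subset)
qed

section \<open>Smoothness of a maximum of polynomials\<close>

text \<open>Agreement on a neighbourhood passes to derivatives: f becomes \<open>deriv f\<close> and
  q becomes \<open>pderiv q\<close>, which is why q is generalised in the induction.\<close>

lemma times_differentiable_at_poly:
  assumes "\<forall>\<^sub>F y in nhds z. f y = poly q y"
  shows "times_differentiable_at m f z"
  using assms
proof (induction m f z arbitrary: q rule: times_differentiable_at.induct)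
  case (1 f z)
  then show ?case
    by (simp add: isCont_cong)
next
  case (2 f z)
  have "(f has_real_derivative poly (pderiv q) z) (at z)"
    using 2 by (subst DERIV_cong_ev[OF refl _ refl]) (auto intro: poly_DERIV)
  then show ?case
    by (auto simp: real_differentiable_def)
next
  case (3 m f z)
  \<comment> \<open>Agreement near z is also agreement near every y close to z, which gives the
    derivative on a whole neighbourhood.\<close>
  have deriv: "\<forall>\<^sub>F y in nhds z. (f has_real_derivative poly (pderiv q) y) (at y)"
    using eventually_eventually[THEN iffD2, OF "3.prems"]
  proof (rule eventually_mono)
    fix y assume "\<forall>\<^sub>F x in nhds y. f x = poly q x"
    then show "(f has_real_derivative poly (pderiv q) y) (at y)"
      by (subst DERIV_cong_ev[OF refl _ refl]) (auto intro: poly_DERIV)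
  qed
  then have "\<forall>\<^sub>F y in nhds z. deriv f y = poly (pderiv q) y"
    by (rule eventually_mono) (rule DERIV_imp_deriv)
  moreover have "\<forall>\<^sub>F y in nhds z. f differentiable (at y)"
    using deriv by (rule eventually_mono) (auto simp: real_differentiable_def)
  ultimately show ?case
    using "3.IH" by simp
qed

text \<open>Distinct values at z make the maximiser there strict. Strictness persists nearby by
  continuity, and finitely many neighbourhoods intersect in one.\<close>

lemma eventually_Max_eq_poly:
  fixes P :: "real poly set"
  assumes "finite P" "P \<noteq> {}" "inj_on (\<lambda>q. poly q z) P"
  obtains q where "q \<in> P" "\<forall>\<^sub>F y in nhds z. Max ((\<lambda>q. poly q y) ` P) = poly q y"
proof -
  have "Max ((\<lambda>q. poly q z) ` P) \<in> (\<lambda>q. poly q z) ` P"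
    using assms by (intro Max_in) auto
  then obtain q where q: "q \<in> P" "Max ((\<lambda>q. poly q z) ` P) = poly q z"
    by auto
  have "\<forall>\<^sub>F y in nhds z. poly q' y \<le> poly q y" if "q' \<in> P" for q'
  proof (cases "q' = q")
    case False
    have "poly q' z \<le> poly q z"
      using that assms(1) q(2)[symmetric] by simp
    moreover have "poly q' z \<noteq> poly q z"
      using that False q(1) assms(3) by (auto simp: inj_on_def)
    ultimately have "poly q' z < poly q z"
      by simp
    moreover have "open {y. poly q' y < poly q y}"
      by (intro open_Collect_less continuous_intros)
    ultimately have "\<forall>\<^sub>F y in nhds z. y \<in> {y. poly q' y < poly q y}"
      by (intro eventually_nhds_in_open) auto
    then show ?thesis
      by (rule eventually_mono) simp
  qed simp
  then have "\<forall>\<^sub>F y in nhds z. \<forall>q'\<in>P. poly q' y \<le> poly q y"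
    using assms(1) by (simp add: eventually_ball_finite_distrib)
  then have "\<forall>\<^sub>F y in nhds z. Max ((\<lambda>q. poly q y) ` P) = poly q y"
    by (rule eventually_mono) (use assms(1) q(1) in \<open>auto intro!: Max_eqI\<close>)
  with q(1) show thesis
    by (rule that)
qed

theorem theorem7p3:
  fixes V :: "'v set" and E :: "'v set set" and s r :: 'v and a b :: int
  assumes "simple_graph V E" and "s \<in> V" and "r \<in> V"
    and "b \<ge> 1" and "real_of_int a / real_of_int b \<in> {0..1}"
  shows "\<not> (\<exists>p. breakpoint (rho_hat V E s r) p \<and>
           0 < \<bar>p - real_of_int a / real_of_int b\<bar> \<and>
           \<bar>p - real_of_int a / real_of_int b\<bar> < (3 * real_of_int b) powi (- int (card E)))"
proof
  assume "\<exists>p. breakpoint (rho_hat V E s r) p \<and>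
           0 < \<bar>p - real_of_int a / real_of_int b\<bar> \<and>
           \<bar>p - real_of_int a / real_of_int b\<bar> < (3 * real_of_int b) powi (- int (card E))"
  then obtain z m where z: "z \<in> {0<..<1}" "0 < \<bar>z - a / b\<bar>"
      "\<bar>z - a / b\<bar> < 1 / (3 * real_of_int b) ^ card E"
    and not_diff: "\<not> times_differentiable_at m (rho_hat V E s r) z"
    by (auto simp: breakpoint_def breakpoint_of_order_def power_int_minus inverse_eq_divide)
  have E: "finite E"
    using assms(1) by (rule finite_edges)
  have ab: "0 \<le> a" "a \<le> b"
    using assms(4,5) by (auto simp: zero_le_divide_iff)
  define walk_sets where "walk_sets A = {S \<in> Pow E. (\<lambda>e. e \<in> S) \<in>
    {\<omega>. \<exists>xs \<in> protocol_walks V E s r A. \<forall>e \<in> walk_edges xs. \<omega> e}}" for A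
  \<comment> \<open>Taking a set of polynomials merges protocols with the same one, so injectivity
    of evaluation at z is exactly what \<open>edge_set_poly_eq\<close> yields.\<close>
  define P where "P = (\<lambda>A. edge_set_poly (card E) (walk_sets A)) ` finite_protocols V E s r"
  have rho_hat: "rho_hat V E s r y = Max ((\<lambda>q. poly q y) ` P)" if "y \<in> {0..1}" for y
    using that by (simp add: rho_hat_def rho_def P_def walk_sets_def image_image
        prob_survival_pmf[OF E])
  have "inj_on (\<lambda>q. poly q z) P"
    unfolding P_def inj_on_def
    by (auto intro!: edge_set_poly_eq[OF E _ _ assms(4) ab z(2,3)] simp: walk_sets_def)
  moreover have "finite P" "P \<noteq> {}"
    unfolding P_def using finite_finite_protocols[OF assms(1), of s r]
      empty_in_finite_protocols[OF assms(1), of s r] by blast+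
  ultimately obtain q where q: "\<forall>\<^sub>F y in nhds z. Max ((\<lambda>q. poly q y) ` P) = poly q y"
    using eventually_Max_eq_poly by blast
  \<comment> \<open>The polynomial form of \<open>rho_hat\<close> is available on the unit interval,
    so the neighbourhood is shrunk into it.\<close>
  have "\<forall>\<^sub>F y in nhds z. y \<in> {0<..<1}"
    using z(1) by (intro eventually_nhds_in_open) auto
  with q have "\<forall>\<^sub>F y in nhds z. rho_hat V E s r y = poly q y"
    by eventually_elim (simp add: rho_hat)
  then show False
    using times_differentiable_at_poly not_diff by blast
qed

end
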